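(* Let $\mathbb F$ be a differential field with field of constants $\mathbb K$. If $M\in \mathbb F^{n,n}$ is nonderogatory and $MM' = M'M$, then $M$ is of Type 1.
   Context: A differential field $\mathbb F$ is an (algebraic) field together with an additional operation ${}'$ (the derivative) satisfying $(a+b)'=a'+b'$ and $(ab)'=ab'+a'b$ for all $a,b\in\mathbb F$. An element $a\in\mathbb F$ is a constant if $a'=0$; the constants form a subfield $\mathbb K$ of $\mathbb F$, called the field of constants. $\mathbb F^{n,n}$ denotes the $n\times n$ matrices over $\mathbb F$, and for $M=[m_{i,j}]\in\mathbb F^{n,n}$ the derivative $M'=[m_{i,j}']$ is taken entrywise. A matrix $M\in\mathbb F^{n,n}$ is nonderogatory if its characteristic polynomial equals its minimal polynomial. A matrix $M\in\mathbb F^{n,n}$ is of Type 1 if $M=\sum_{j=1}^{k} f_j C_j$ for some $f_j\in\mathbb F$ and some pairwise commuting $C_j\in\mathbb K^{n,n}$, $j=1,\ldots,k$. *)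

theory Defs
  imports "Jordan_Normal_Form.Char_Poly"
begin

locale differential_field =
  fixes D :: "'a :: field \<Rightarrow> 'a"
  assumes deriv_add: "D (a + b) = D a + D b"
    and deriv_mult: "D (a * b) = D a * b + a * D b"

definition constants :: "('a :: field \<Rightarrow> 'a) \<Rightarrow> 'a set" where
  "constants D = {a. D a = 0}"

definition const_mat :: "('a :: field \<Rightarrow> 'a) \<Rightarrow> nat \<Rightarrow> 'a mat set" where
  "const_mat D n = {C \<in> carrier_mat n n. elements_mat C \<subseteq> constants D}"

definition mat_deriv :: "('a :: field \<Rightarrow> 'a) \<Rightarrow> 'a mat \<Rightarrow> 'a mat" where
  "mat_deriv D M = map_mat D M"

definition poly_mat :: "'a :: field poly \<Rightarrow> 'a mat \<Rightarrow> 'a mat" where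
  "poly_mat p A = (\<Oplus>\<^bsub>module_mat TYPE('a) (dim_row A) (dim_row A)\<^esub> i \<in> {..degree p}. coeff p i \<cdot>\<^sub>m (A ^\<^sub>m i))"

definition is_min_poly :: "'a :: field mat \<Rightarrow> 'a poly \<Rightarrow> bool" where
  "is_min_poly A p \<longleftrightarrow> lead_coeff p = 1 \<and> poly_mat p A = 0\<^sub>m (dim_row A) (dim_row A) \<and>
     (\<forall>q. q \<noteq> 0 \<and> poly_mat q A = 0\<^sub>m (dim_row A) (dim_row A) \<longrightarrow> degree p \<le> degree q)"

(* Well defined for square A, see min_poly_ex1 below. *)
definition min_poly :: "'a :: field mat \<Rightarrow> 'a poly" where
  "min_poly A = (THE p. is_min_poly A p)"

definition nonderogatory :: "'a :: field mat \<Rightarrow> bool" where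
  "nonderogatory A \<longleftrightarrow> char_poly A = min_poly A"

definition type1 :: "('a :: field \<Rightarrow> 'a) \<Rightarrow> nat \<Rightarrow> 'a mat \<Rightarrow> bool" where
  "type1 D n M \<longleftrightarrow> (\<exists>(k :: nat) (f :: nat \<Rightarrow> 'a) (C :: nat \<Rightarrow> 'a mat).
     (\<forall>j \<in> {1..k}. C j \<in> const_mat D n) \<and>
     (\<forall>i \<in> {1..k}. \<forall>j \<in> {1..k}. C i * C j = C j * C i) \<and>
     M = (\<Oplus>\<^bsub>module_mat TYPE('a) n n\<^esub> j \<in> {1..k}. f j \<cdot>\<^sub>m C j))"

lemma (in differential_field) constants_closed:
  "0 \<in> constants D" "1 \<in> constants D"
  "a \<in> constants D \<Longrightarrow> b \<in> constants D \<Longrightarrow> a + b \<in> constants D"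
  "a \<in> constants D \<Longrightarrow> b \<in> constants D \<Longrightarrow> a * b \<in> constants D"
  "a \<in> constants D \<Longrightarrow> - a \<in> constants D"
  "a \<in> constants D \<Longrightarrow> inverse a \<in> constants D"
proof -
  have z: "D 0 = 0" using deriv_add[of 0 0] by (metis add_cancel_right_right add.right_neutral)
  have o: "D 1 = 0" using deriv_mult[of 1 1] by (metis add_cancel_right_right mult_1 mult_1_right)
  show "0 \<in> constants D" "1 \<in> constants D" using z o by (auto simp: constants_def)
  show "a \<in> constants D \<Longrightarrow> b \<in> constants D \<Longrightarrow> a + b \<in> constants D"
    "a \<in> constants D \<Longrightarrow> b \<in> constants D \<Longrightarrow> a * b \<in> constants D"
    by (auto simp: constants_def deriv_add deriv_mult)
  show "a \<in> constants D \<Longrightarrow> - a \<in> constants D"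
    using deriv_add[of a "- a"] z by (simp add: constants_def)
  show "inverse a \<in> constants D" if "a \<in> constants D"
  proof (cases "a = 0")
    case False
    then show ?thesis using deriv_mult[of a "inverse a"] o that by (simp add: constants_def)
  qed (simp add: constants_def z)
qed

lemma finsum_mat:
  fixes X :: "'i \<Rightarrow> 'a :: comm_ring_1 mat"
  assumes "finite S" "\<And>i. i \<in> S \<Longrightarrow> X i \<in> carrier_mat m n"
  shows "(\<Oplus>\<^bsub>module_mat TYPE('a) m n\<^esub> i \<in> S. X i) = mat m n (\<lambda>rc. \<Sum>i\<in>S. X i $$ rc)"
  using assms
proof (induction S rule: finite_induct)
  interpret abelian_group "module_mat TYPE('a) m n" by (rule abelian_group_mat)
  case empty
  show ?case by (rule eq_matI) (auto simp: module_mat_simps)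
next
  interpret abelian_group "module_mat TYPE('a) m n" by (rule abelian_group_mat)
  case (insert x S)
  have "(\<Oplus>\<^bsub>module_mat TYPE('a) m n\<^esub> i \<in> insert x S. X i)
     = X x + (\<Oplus>\<^bsub>module_mat TYPE('a) m n\<^esub> i \<in> S. X i)"
    using insert by (subst finsum_insert) (auto simp: module_mat_simps Pi_def)
  also have "\<dots> = X x + mat m n (\<lambda>rc. \<Sum>i\<in>S. X i $$ rc)" using insert by simp
  also have "\<dots> = mat m n (\<lambda>rc. \<Sum>i\<in>insert x S. X i $$ rc)"
    using insert.prems[of x] insert.hyps by (intro eq_matI) auto
  finally show ?case .
qed

lemma poly_mat_index:
  fixes A :: "'a :: field mat"
  assumes A: "A \<in> carrier_mat n n" and N: "degree p \<le> N"
  shows "poly_mat p A = mat n n (\<lambda>rc. \<Sum>i\<le>N. coeff p i * (A ^\<^sub>m i) $$ rc)"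
proof -
  have d: "dim_row A = n" using A by simp
  have P: "A ^\<^sub>m i \<in> carrier_mat n n" for i using A by simp
  have "poly_mat p A = mat n n (\<lambda>rc. \<Sum>i\<le>degree p. (coeff p i \<cdot>\<^sub>m A ^\<^sub>m i) $$ rc)"
    unfolding poly_mat_def d using P by (intro finsum_mat) auto
  also have "\<dots> = mat n n (\<lambda>rc. \<Sum>i\<le>N. coeff p i * (A ^\<^sub>m i) $$ rc)"
  proof (rule eq_matI, goal_cases)
    case (1 r c)
    have "(\<Sum>i\<le>degree p. coeff p i * (A ^\<^sub>m i) $$ (r,c)) = (\<Sum>i\<le>N. coeff p i * (A ^\<^sub>m i) $$ (r,c))"
      using N by (intro sum.mono_neutral_left) (auto intro: coeff_eq_0)
    then show ?case using 1 A by simp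
  qed auto
  finally show ?thesis .
qed

lemma ex_annihilating_poly:
  fixes A :: "'a :: field mat"
  assumes A: "A \<in> carrier_mat n n"
  shows "\<exists>p. p \<noteq> 0 \<and> poly_mat p A = 0\<^sub>m n n"
proof -
  let ?N = "n * n"
  let ?B = "mat (Suc ?N) (Suc ?N) (\<lambda>(k, i). if k = ?N then 0 else (A ^\<^sub>m i) $$ (k div n, k mod n))"
  have B: "?B \<in> carrier_mat (Suc ?N) (Suc ?N)" by simp
  have "det ?B = 0"
  proof -
    have "det ?B = (\<Sum>j<Suc ?N. ?B $$ (?N, j) * cofactor ?B ?N j)"
      by (rule laplace_expansion_row[OF B]) simp
    also have "\<dots> = 0" by (rule sum.neutral) auto
    finally show ?thesis .
  qed
  then obtain v where v: "v \<in> carrier_vec (Suc ?N)" "v \<noteq> 0\<^sub>v (Suc ?N)" "?B *\<^sub>v v = 0\<^sub>v (Suc ?N)"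
    using det_0_iff_vec_prod_zero[OF B] by auto
  define p where "p = (\<Sum>i\<le>?N. monom (v $ i) i)"
  have c: "coeff p i = (if i \<le> ?N then v $ i else 0)" for i
    by (simp add: p_def coeff_sum)
  have deg: "degree p \<le> ?N" by (rule degree_le) (auto simp: c)
  have "\<exists>i<Suc ?N. v $ i \<noteq> 0"
  proof (rule ccontr)
    assume "\<not> ?thesis"
    then have "v = 0\<^sub>v (Suc ?N)" using v(1) by (intro eq_vecI) auto
    with v(2) show False by simp
  qed
  then obtain i where "i \<le> ?N" "v $ i \<noteq> 0" by (auto simp: less_Suc_eq_le)
  then have "p \<noteq> 0" using c[of i] by auto
  moreover have "poly_mat p A = 0\<^sub>m n n"
    unfolding poly_mat_index[OF A deg]
  proof (rule eq_matI, goal_cases)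
    case (1 r s)
    then have r: "r < n" and s: "s < n" by auto
    define k where "k = r * n + s"
    have "k < Suc r * n" using s by (simp add: k_def)
    also have "\<dots> \<le> ?N" using r by (intro mult_le_mono1) simp
    finally have k: "k < ?N" .
    have ks: "k div n = r" "k mod n = s" using s by (simp_all add: k_def)
    have "0 = (?B *\<^sub>v v) $ k" using k v(3) by simp
    also have "\<dots> = (\<Sum>i<Suc ?N. (A ^\<^sub>m i) $$ (r, s) * v $ i)"
      using k v(1) by (simp add: scalar_prod_def ks lessThan_atLeast0)
    also have "\<dots> = (\<Sum>i\<le>?N. coeff p i * (A ^\<^sub>m i) $$ (r, s))"
      by (simp only: lessThan_Suc_atMost) (auto intro!: sum.cong simp: c)
    finally show ?case using r s by simp
  qed auto
  ultimately show ?thesis by blast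
qed

lemma min_poly_ex1:
  fixes A :: "'a :: field mat"
  assumes A: "A \<in> carrier_mat n n"
  shows "\<exists>!p. is_min_poly A p"
proof -
  have d: "dim_row A = n" using A by simp
  let ?Q = "\<lambda>q. q \<noteq> 0 \<and> poly_mat q A = 0\<^sub>m n n"
  have smult: "poly_mat (Polynomial.smult c q) A = 0\<^sub>m n n" if "poly_mat q A = 0\<^sub>m n n" for c and q :: "'a poly"
  proof -
    have "poly_mat (Polynomial.smult c q) A = c \<cdot>\<^sub>m poly_mat q A"
      unfolding poly_mat_index[OF A order.refl] poly_mat_index[OF A degree_smult_le]
      by (rule eq_matI)
        (simp_all add: sum_distrib_left mult.assoc poly_mat_index[OF A degree_smult_le])
    then show ?thesis using that by (simp add: smult_zero_mat)
  qed
  obtain q0 where "?Q q0" using ex_annihilating_poly[OF A] by blast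
  then obtain q where q: "?Q q" "\<And>r. ?Q r \<Longrightarrow> degree q \<le> degree r"
    using ex_has_least_nat[of ?Q q0 degree] by blast
  show ?thesis
  proof (rule ex_ex1I)
    have "is_min_poly A (Polynomial.smult (inverse (lead_coeff q)) q)"
      unfolding is_min_poly_def d using q smult[of q] by simp
    then show "\<exists>p. is_min_poly A p" ..
  next
    fix p r assume pr: "is_min_poly A p" "is_min_poly A r"
    then have nz: "p \<noteq> 0" "r \<noteq> 0" by (auto simp: is_min_poly_def)
    with pr have deg: "degree p = degree r" unfolding is_min_poly_def by (meson order.antisym)
    show "p = r"
    proof (rule ccontr)
      assume ne: "p \<noteq> r"
      have le: "degree (p - r) \<le> degree p" using degree_diff_le[of p "degree p" r] deg by simp
      have "coeff (p - r) (degree p) = 0" using pr deg by (simp add: is_min_poly_def)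
      then have lt: "degree (p - r) < degree p"
        using le ne by (metis eq_iff_diff_eq_0 leading_coeff_0_iff order.not_eq_order_implies_strict)
      have z: "poly_mat p A = 0\<^sub>m n n" "poly_mat r A = 0\<^sub>m n n"
        using pr by (auto simp: is_min_poly_def d)
      have "poly_mat (p - r) A = poly_mat p A - poly_mat r A"
        unfolding poly_mat_index[OF A le] poly_mat_index[OF A order.refl, of p]
          poly_mat_index[OF A eq_refl[OF deg[symmetric]]]
        by (rule eq_matI) (simp_all add: left_diff_distrib sum_subtractf)
      then have "poly_mat (p - r) A = 0\<^sub>m n n" using z by simp
      then have "degree p \<le> degree (p - r)" using pr(1) ne by (simp add: is_min_poly_def d)
      with lt show False by simp
    qed
  qed
qed

lemma is_min_poly_min_poly:
  fixes A :: "'a :: field mat"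
  assumes "A \<in> carrier_mat n n"
  shows "is_min_poly A (min_poly A)"
  unfolding min_poly_def by (rule theI'[OF min_poly_ex1[OF assms]])

end

theory Submission
  imports Defs "HOL-Computational_Algebra.Polynomial_Factorial"
begin

text \<open>
  A nonderogatory \<open>M\<close> has a cyclic vector: for each prime power \<open>p\<^sup>e\<close> dividing the minimal polynomial
  there is a vector with annihilator generated by \<open>p\<^sup>e\<close>, and when vectors with coprime annihilators
  are added, the annihilators multiply. So everything commuting with \<open>M\<close> is a polynomial in \<open>M\<close>;
  in particular \<open>M'\<close> is, and the space \<open>W\<close> of polynomials in \<open>M\<close> is closed under differentiation.
  A nonzero matrix of minimal support in such a space, scaled to have an entry 1, is constant: its
  derivative lies in the space and has strictly smaller support. Subtracting multiples of such
  matrices shows that \<open>M\<close> is a combination of constant elements of \<open>W\<close>, and these commute.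
\<close>

section \<open>Polynomials over a field\<close>

text \<open>A nonzero member of least degree generates: the remainder of any member modulo it stays
  in the ideal and has smaller degree, so it vanishes. Applied below to the polynomials killing a
  vector and to those killing a matrix.\<close>

lemma poly_ideal_principal:
  fixes I :: "'a :: field poly set"
  assumes nz: "q \<in> I" "q \<noteq> 0"
    and add: "\<And>p q. p \<in> I \<Longrightarrow> q \<in> I \<Longrightarrow> p + q \<in> I"
    and mult: "\<And>p q. q \<in> I \<Longrightarrow> p * q \<in> I"
  obtains f where "f \<noteq> 0" "\<And>g. g \<in> I \<longleftrightarrow> f dvd g"
proof -
  obtain f where f: "f \<in> I \<and> f \<noteq> 0" "\<And>r. r \<in> I \<and> r \<noteq> 0 \<Longrightarrow> degree f \<le> degree r"
    using ex_has_least_nat[of "\<lambda>r. r \<in> I \<and> r \<noteq> 0" q degree] nz by blast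
  have "f dvd g" if "g \<in> I" for g
  proof -
    have "g mod f = g + - (g div f) * f" by (simp add: minus_div_mult_eq_mod [symmetric])
    also have "\<dots> \<in> I" using that f(1) add mult by blast
    finally have "g mod f \<in> I" .
    then have "g mod f = 0" using f degree_mod_less[of f g] by force
    then show ?thesis by auto
  qed
  then show thesis using f(1) mult that by (metis dvdE mult.commute)
qed

text \<open>A divisor of least positive degree is irreducible because degrees add under
  multiplication, and irreducible polynomials over a field are prime.\<close>

lemma ex_prime_elem_dvd_poly:
  fixes f :: "'a :: field poly"
  assumes "degree f > 0"
  obtains p where "prime_elem p" "degree p > 0" "p dvd f"
proof -
  obtain p where p: "p dvd f \<and> degree p > 0" "\<And>r. r dvd f \<and> degree r > 0 \<Longrightarrow> degree p \<le> degree r"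
    using ex_has_least_nat[of "\<lambda>r. r dvd f \<and> degree r > 0" f degree, OF conjI[OF dvd_refl assms]]
    by metis
  have nz: "p \<noteq> 0" using p(1) by auto
  have "irreducible p"
  proof (rule irreducibleI)
    show "\<not> p dvd 1" using p(1) by (auto simp: is_unit_iff_degree nz)
    fix a b assume ab: "p = a * b"
    then have n: "a \<noteq> 0" "b \<noteq> 0" using nz by auto
    have "a dvd f" "b dvd f" using p(1) unfolding ab by (blast dest: dvd_mult_left dvd_mult_right)+
    then have "degree a = 0 \<or> degree a \<ge> degree p" "degree b = 0 \<or> degree b \<ge> degree p"
      using p(2)[of a] p(2)[of b] by (simp_all, linarith+)
    moreover have "degree p = degree a + degree b" using ab n by (simp add: degree_mult_eq)
    ultimately show "a dvd 1 \<or> b dvd 1" using n p(1) by (auto simp: is_unit_iff_degree)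
  qed (use nz in auto)
  then show thesis using that p(1) field_poly_irreducible_imp_prime by blast
qed

lemma poly_power_factor:
  fixes f p :: "'a :: field poly"
  assumes "f \<noteq> 0" "degree p > 0"
  obtains e g where "f = p ^ e * g" "\<not> p dvd g"
proof -
  have "\<exists>e g. f = p ^ e * g \<and> \<not> p dvd g" using assms(1)
  proof (induction "degree f" arbitrary: f rule: less_induct)
    case less
    show ?case
    proof (cases "p dvd f")
      case True
      then obtain h where h: "f = p * h" by (rule dvdE)
      then have "degree h < degree f" "h \<noteq> 0" using less.prems assms(2) by (auto simp: degree_mult_eq)
      then obtain e g where "h = p ^ e * g" "\<not> p dvd g" using less.hyps by blast
      then show ?thesis using h by (intro exI[of _ "Suc e"] exI[of _ g]) auto
    qed (auto intro: exI[of _ 0])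
  qed
  then show thesis using that by blast
qed

text \<open>Factors \<open>p\<close> are cancelled one at a time: in
  \<open>p * (p ^ e * h) = g * k\<close> the prime \<open>p\<close> does not divide
  \<open>g\<close>, so it divides \<open>k\<close>.\<close>

lemma prime_elem_power_dvd_cancel:
  fixes p :: "'a :: idom"
  assumes "prime_elem p" "\<not> p dvd g" "g dvd p ^ e * h"
  shows "g dvd h"
  using assms(3)
proof (induction e)
  case (Suc e)
  then obtain k where k: "p * (p ^ e * h) = g * k" by (auto simp: mult.assoc)
  then have "p dvd k" using assms(1,2) by (metis dvd_triv_left prime_elem_dvd_mult_iff)
  then obtain k' where "k = p * k'" by auto
  then have "p ^ e * h = g * k'" using k assms(1) by (auto simp: prime_elem_def)
  then show ?case using Suc.IH by simp
qed simp

section \<open>Polynomials of a matrix\<close>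

lemma poly_mat_carrier [simp]:
  "A \<in> carrier_mat n n \<Longrightarrow> poly_mat p A \<in> carrier_mat n n"
  by (simp add: poly_mat_index[OF _ order.refl])

lemma poly_mat_0:
  "A \<in> carrier_mat n n \<Longrightarrow> poly_mat 0 A = 0\<^sub>m n n"
  by (rule eq_matI) (simp_all add: poly_mat_index[OF _ order.refl])

lemma poly_mat_add:
  assumes A: "A \<in> carrier_mat n n"
  shows "poly_mat (p + q) A = poly_mat p A + poly_mat q A"
proof -
  define N where "N = max (degree p) (degree q)"
  have N: "degree p \<le> N" "degree q \<le> N" "degree (p + q) \<le> N"
    by (auto simp: N_def degree_add_le_max)
  show ?thesis unfolding N[THEN poly_mat_index[OF A]]
    by (rule eq_matI) (simp_all add: algebra_simps sum.distrib)
qed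

lemma poly_mat_smult:
  assumes A: "A \<in> carrier_mat n n"
  shows "poly_mat (Polynomial.smult c p) A = c \<cdot>\<^sub>m poly_mat p A"
  unfolding poly_mat_index[OF A degree_smult_le] poly_mat_index[OF A order.refl]
  by (rule eq_matI) (simp_all add: sum_distrib_left mult.assoc)

text \<open>The Horner step. It replaces the sum over coefficients by a recursion, so that
  commutation, multiplicativity and differentiation go by induction over
  \<open>pCons\<close>.\<close>

lemma poly_mat_pCons:
  assumes A: "A \<in> carrier_mat n n"
  shows "poly_mat (pCons a p) A = a \<cdot>\<^sub>m 1\<^sub>m n + poly_mat p A * A"
proof (rule eq_matI)
  fix r c assume "r < dim_row (a \<cdot>\<^sub>m 1\<^sub>m n + poly_mat p A * A)"
    "c < dim_col (a \<cdot>\<^sub>m 1\<^sub>m n + poly_mat p A * A)"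
  then have r: "r < n" and c: "c < n" using A poly_mat_carrier[OF A, of p] by auto
  have pw: "A ^\<^sub>m i \<in> carrier_mat n n" for i using A by simp
  have "(poly_mat p A * A) $$ (r,c) = (\<Sum>k<n. poly_mat p A $$ (r,k) * A $$ (k,c))"
    using r c A carrier_matD[OF poly_mat_carrier[OF A, of p]] by (simp add: scalar_prod_def lessThan_atLeast0)
  also have "\<dots> = (\<Sum>k<n. \<Sum>i\<le>degree p. coeff p i * ((A ^\<^sub>m i) $$ (r,k) * A $$ (k,c)))"
    using r by (auto simp: poly_mat_index[OF A order.refl] sum_distrib_right mult.assoc intro!: sum.cong)
  also have "\<dots> = (\<Sum>i\<le>degree p. coeff p i * (\<Sum>k<n. (A ^\<^sub>m i) $$ (r,k) * A $$ (k,c)))"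
    by (subst sum.swap) (simp add: sum_distrib_left)
  also have "\<dots> = (\<Sum>i\<le>degree p. coeff p i * (A ^\<^sub>m Suc i) $$ (r,c))"
    using r c A pw by (intro sum.cong refl) (auto simp: scalar_prod_def lessThan_atLeast0)
  finally have PA: "(poly_mat p A * A) $$ (r,c) = (\<Sum>i\<le>degree p. coeff p i * (A ^\<^sub>m Suc i) $$ (r,c))" .
  \<comment> \<open>A bound rather than the exact degree: it also covers \<open>p = 0\<close>, where
    the additional coefficient is zero.\<close>
  have d: "degree (pCons a p) \<le> Suc (degree p)" by (rule degree_pCons_le)
  have "poly_mat (pCons a p) A $$ (r,c) = a * (1\<^sub>m n) $$ (r,c) + (\<Sum>i\<le>degree p. coeff p i * (A ^\<^sub>m Suc i) $$ (r,c))"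
    using r c A unfolding poly_mat_index[OF A d] by (simp del: pow_mat.simps(2) sum.atMost_Suc add: sum.atMost_Suc_shift)
  then show "poly_mat (pCons a p) A $$ (r,c) = (a \<cdot>\<^sub>m 1\<^sub>m n + poly_mat p A * A) $$ (r,c)"
    using PA r c A carrier_matD[OF poly_mat_carrier[OF A, of p]] by simp
qed (use A carrier_matD[OF poly_mat_carrier[OF A, of p]]
    carrier_matD[OF poly_mat_carrier[OF A, of "pCons a p"]] in auto)

lemma pow_mat_commute:
  assumes A: "A \<in> carrier_mat n n" and X: "X \<in> carrier_mat n n" and comm: "X * A = A * X"
  shows "X * A ^\<^sub>m j = A ^\<^sub>m j * X"
proof (induction j)
  case 0
  show ?case using A X by simp
next
  case (Suc j)
  have P: "A ^\<^sub>m j \<in> carrier_mat n n" using A by simp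
  show ?case
    by (simp only: pow_mat.simps(2) assoc_mult_mat[OF X P A, symmetric] Suc.IH
        assoc_mult_mat[OF P X A] comm assoc_mult_mat[OF P A X])
qed

lemma poly_mat_commute:
  assumes A: "A \<in> carrier_mat n n" and X: "X \<in> carrier_mat n n" and comm: "X * A = A * X"
  shows "X * poly_mat p A = poly_mat p A * X"
proof (induction p)
  case 0
  then show ?case using A X by (simp add: poly_mat_0)
next
  case (pCons a p)
  note P = poly_mat_carrier[OF A, of p]
  have "X * poly_mat (pCons a p) A = X * (a \<cdot>\<^sub>m 1\<^sub>m n) + X * (poly_mat p A * A)"
    unfolding poly_mat_pCons[OF A] by (rule mult_add_distrib_mat[OF X]) (use mult_carrier_mat[OF P A] in auto)
  also have "X * (poly_mat p A * A) = poly_mat p A * A * X"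
    by (simp only: assoc_mult_mat[OF X P A, symmetric] pCons.IH assoc_mult_mat[OF P X A] comm
        assoc_mult_mat[OF P A X, symmetric])
  also have "X * (a \<cdot>\<^sub>m 1\<^sub>m n) = (a \<cdot>\<^sub>m 1\<^sub>m n) * X"
    using X by (simp add: mult_smult_distrib[OF X one_carrier_mat] mult_smult_assoc_mat[OF one_carrier_mat X])
  also have "(a \<cdot>\<^sub>m 1\<^sub>m n) * X + poly_mat p A * A * X = poly_mat (pCons a p) A * X"
    unfolding poly_mat_pCons[OF A] using mult_carrier_mat[OF P A] X by (intro add_mult_distrib_mat[symmetric]) auto
  finally show ?case .
qed

lemma poly_mat_mult:
  assumes A: "A \<in> carrier_mat n n"
  shows "poly_mat (p * q) A = poly_mat p A * poly_mat q A"
proof (induction p)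
  case 0
  then show ?case using poly_mat_carrier[OF A, of q] by (simp add: poly_mat_0[OF A] left_mult_zero_mat)
next
  case (pCons a p)
  note P = poly_mat_carrier[OF A, of p] and Q = poly_mat_carrier[OF A, of q]
  have AQ: "A * poly_mat q A = poly_mat q A * A" by (rule poly_mat_commute[OF A A refl])
  have PA: "poly_mat p A * A \<in> carrier_mat n n" by (rule mult_carrier_mat[OF P A])
  \<comment> \<open>\<open>pCons a p * q\<close> unfolds to
    \<open>smult a q + pCons 0 (p * q)\<close>; this removes the constant term of the second
    summand.\<close>
  have "0 \<cdot>\<^sub>m 1\<^sub>m n = (0\<^sub>m n n :: 'a mat)" by (rule eq_matI) auto
  then have "poly_mat (pCons a p * q) A = a \<cdot>\<^sub>m poly_mat q A + poly_mat p A * poly_mat q A * A"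
    using left_add_zero_mat[OF mult_carrier_mat[OF mult_carrier_mat[OF P Q] A]]
    by (simp add: poly_mat_add[OF A] poly_mat_smult[OF A] poly_mat_pCons[OF A] pCons.IH)
  also have "poly_mat p A * poly_mat q A * A = poly_mat p A * A * poly_mat q A"
    by (simp only: assoc_mult_mat[OF P Q A] AQ[symmetric] assoc_mult_mat[OF P A Q, symmetric])
  also have "a \<cdot>\<^sub>m poly_mat q A = a \<cdot>\<^sub>m 1\<^sub>m n * poly_mat q A"
    by (simp add: mult_smult_assoc_mat[OF one_carrier_mat Q] left_mult_one_mat[OF Q])
  also have "a \<cdot>\<^sub>m 1\<^sub>m n * poly_mat q A + poly_mat p A * A * poly_mat q A = poly_mat (pCons a p) A * poly_mat q A"
    unfolding poly_mat_pCons[OF A] using PA Q by (intro add_mult_distrib_mat[symmetric]) auto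
  finally show ?case .
qed

section \<open>Cyclic vectors\<close>

text \<open>A relation, since \<open>f\<close> may be any generator of the ideal of polynomials
  killing \<open>v\<close>; without a monic normalisation it is determined only up to a
  unit.\<close>

definition is_annihilator :: "'a :: field mat \<Rightarrow> 'a vec \<Rightarrow> 'a poly \<Rightarrow> bool" where
  "is_annihilator A v f \<longleftrightarrow> v \<in> carrier_vec (dim_row A) \<and>
     (\<forall>g. poly_mat g A *\<^sub>v v = 0\<^sub>v (dim_row A) \<longleftrightarrow> f dvd g)"

lemma poly_mat_mult_vec:
  assumes "A \<in> carrier_mat n n" "v \<in> carrier_vec n"
  shows "poly_mat (p * q) A *\<^sub>v v = poly_mat p A *\<^sub>v (poly_mat q A *\<^sub>v v)"
  unfolding poly_mat_mult[OF assms(1)]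
  by (rule assoc_mult_mat_vec[OF poly_mat_carrier poly_mat_carrier]) (use assms in auto)

lemma mult_mat_zero_vec: "P \<in> carrier_mat n m \<Longrightarrow> P *\<^sub>v 0\<^sub>v m = 0\<^sub>v n"
  by (rule eq_vecI) auto

lemma poly_mat_mult_vec_zero:
  assumes "A \<in> carrier_mat n n" "v \<in> carrier_vec n" "poly_mat q A *\<^sub>v v = 0\<^sub>v n"
  shows "poly_mat (p * q) A *\<^sub>v v = 0\<^sub>v n"
  using assms by (simp add: poly_mat_mult_vec mult_mat_zero_vec[OF poly_mat_carrier])

lemma ex_is_annihilator:
  assumes A: "A \<in> carrier_mat n n" and v: "v \<in> carrier_vec n"
  obtains f where "is_annihilator A v f"
proof -
  let ?I = "{g. poly_mat g A *\<^sub>v v = 0\<^sub>v n}"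
  \<comment> \<open>A polynomial killing the whole matrix shows that the ideal of \<open>v\<close>
    is nonzero.\<close>
  obtain q where q: "q \<noteq> 0" "poly_mat q A = 0\<^sub>m n n" using ex_annihilating_poly[OF A] by blast
  have z: "0\<^sub>m n n *\<^sub>v v = 0\<^sub>v n" using v by auto
  obtain f where "\<And>g. g \<in> ?I \<longleftrightarrow> f dvd g"
  proof (rule poly_ideal_principal[of q ?I])
    show "q \<in> ?I" using q z by simp
    show "p + q \<in> ?I" if "p \<in> ?I" "q \<in> ?I" for p q
      using that by (auto simp: poly_mat_add[OF A] add_mult_distrib_mat_vec[OF poly_mat_carrier[OF A] poly_mat_carrier[OF A] v])
    show "p * q \<in> ?I" if "q \<in> ?I" for p q
      using that poly_mat_mult_vec_zero[OF A v] by simp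
  qed (use q in auto)
  then have "is_annihilator A v f" unfolding is_annihilator_def using A v by simp
  then show thesis by (rule that)
qed

lemma is_annihilator_zero_vec:
  assumes A: "A \<in> carrier_mat n n" and u: "f dvd 1"
  shows "is_annihilator A (0\<^sub>v n) f"
  using A u unfolding is_annihilator_def by (auto simp: mult_mat_zero_vec[OF poly_mat_carrier[OF A]] simp: unit_imp_dvd)

text \<open>If \<open>h\<close> kills \<open>u + v\<close>, multiplying \<open>h\<close> by the
  annihilator of one summand kills that summand, hence also the other. This gives two
  divisibilities, and coprimality of \<open>p ^ e\<close> and \<open>g\<close> combines
  them.\<close>

lemma is_annihilator_add:
  assumes A: "A \<in> carrier_mat n n"
    and u: "is_annihilator A u (p ^ e)" and v: "is_annihilator A v g"
    and p: "prime_elem p" "\<not> p dvd g"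
  shows "is_annihilator A (u + v) (p ^ e * g)"
proof -
  let ?z = "\<lambda>h w. poly_mat h A *\<^sub>v w = 0\<^sub>v n"
  have c: "u \<in> carrier_vec n" "v \<in> carrier_vec n" and
    iff: "?z h u \<longleftrightarrow> p ^ e dvd h" "?z h v \<longleftrightarrow> g dvd h" for h
    using u v A by (auto simp: is_annihilator_def)
  have vc: "poly_mat h A *\<^sub>v w \<in> carrier_vec n" if "w \<in> carrier_vec n" for h w
    using mult_mat_vec_carrier[OF poly_mat_carrier[OF A] that] .
  have add: "poly_mat h A *\<^sub>v (u + v) = poly_mat h A *\<^sub>v u + poly_mat h A *\<^sub>v v" for h
    by (rule mult_add_distrib_mat_vec[OF poly_mat_carrier[OF A] c])
  have cuv: "u + v \<in> carrier_vec n" using c by auto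
  have "?z h (u + v) \<longleftrightarrow> p ^ e * g dvd h" for h
  proof
    assume "p ^ e * g dvd h"
    then have "?z h u" "?z h v" unfolding iff by (auto intro: dvd_mult_left dvd_mult_right)
    then show "?z h (u + v)" by (simp add: add)
  next
    assume z: "?z h (u + v)"
    have 1: "?z (p ^ e * h) u" "?z (g * h) v" unfolding iff by auto
    have 2: "?z (p ^ e * h) (u + v)" "?z (g * h) (u + v)"
      using poly_mat_mult_vec_zero[OF A cuv z] by auto
    have "?z (p ^ e * h) v" using 1(1) 2(1) vc[OF c(2), of "p ^ e * h"] by (simp add: add)
    then have gh: "g dvd p ^ e * h" by (simp add: iff)
    have "?z (g * h) u" using 1(2) 2(2) vc[OF c(1), of "g * h"] by (simp add: add)
    then have "p ^ e dvd g * h" by (simp add: iff)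
    then have "p ^ e dvd h" using p by (cases "e = 0") (auto intro: prime_power_dvd_multD)
    then obtain k where k: "h = p ^ e * k" by (rule dvdE)
    \<comment> \<open>With \<open>h = p ^ e * k\<close>, both powers of \<open>p\<close> can be
      cancelled, which leaves \<open>g\<close> dividing \<open>k\<close>.\<close>
    have "g dvd p ^ (e + e) * k" using gh k by (simp add: power_add mult.assoc)
    then have "g dvd k" by (rule prime_elem_power_dvd_cancel[OF p])
    then show "p ^ e * g dvd h" using k by auto
  qed
  then show ?thesis using A cuv by (auto simp: is_annihilator_def)
qed

lemma is_annihilator_associated:
  assumes "is_annihilator A v f" "f dvd g" "g dvd f"
  shows "is_annihilator A v g"
  using assms unfolding is_annihilator_def by (meson dvd_trans)

text \<open>Write \<open>m = p ^ e * r\<close> with \<open>e = Suc k\<close>. Since \<open>m\<close>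
  generates the annihilator of the matrix, \<open>p ^ k * r\<close> does not kill it, so it fails to
  kill some unit vector \<open>v\<close>. Applying \<open>r\<close> to \<open>v\<close> gives a
  vector killed by \<open>p ^ e\<close> but not by \<open>p ^ k\<close>.\<close>

lemma ex_is_annihilator_prime_power:
  assumes A: "A \<in> carrier_mat n n"
    and m: "\<And>g. poly_mat g A = 0\<^sub>m n n \<longleftrightarrow> m dvd g" and nz: "m \<noteq> 0"
    and p: "prime_elem p" and mp: "p ^ e dvd m"
  obtains v where "is_annihilator A v (p ^ e)"
proof (cases e)
  case 0
  then show thesis using is_annihilator_zero_vec[OF A, of "p ^ e"] that by auto
next
  case (Suc k)
  obtain r where r: "m = p ^ e * r" using mp by (rule dvdE)
  have mr: "m = p * (p ^ k * r)" and nzr: "p ^ k * r \<noteq> 0" using r nz by (auto simp: Suc)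
  have "\<not> p dvd 1" using p by (auto simp: prime_elem_def)
  then have "\<not> m dvd p ^ k * r"
    using nzr unfolding mr by (metis dvd_mult_cancel_right mult_1)
  then have "poly_mat (p ^ k * r) A \<noteq> 0\<^sub>m n n" by (simp add: m)
  then obtain i j where ij: "i < n" "j < n" "poly_mat (p ^ k * r) A $$ (i,j) \<noteq> 0"
    using poly_mat_carrier[OF A, of "p ^ k * r"] by (metis carrier_matD eq_matI index_zero_mat)
  define v :: "'a vec" where "v = unit_vec n j"
  have v: "v \<in> carrier_vec n" by (simp add: v_def)
  have "(poly_mat (p ^ k * r) A *\<^sub>v v) $ i \<noteq> 0"
    using ij poly_mat_carrier[OF A, of "p ^ k * r"] by (simp add: v_def)
  then have nzv: "poly_mat (p ^ k * r) A *\<^sub>v v \<noteq> 0\<^sub>v n" using ij by auto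
  define w where "w = poly_mat r A *\<^sub>v v"
  have w: "w \<in> carrier_vec n"
    unfolding w_def by (rule mult_mat_vec_carrier[OF poly_mat_carrier[OF A] v])
  obtain f where f: "is_annihilator A w f" using ex_is_annihilator[OF A w] .
  have iff: "poly_mat (g * r) A *\<^sub>v v = 0\<^sub>v n \<longleftrightarrow> f dvd g" for g
    using f A unfolding is_annihilator_def poly_mat_mult_vec[OF A v] w_def[symmetric] by simp
  have "poly_mat (p ^ e * r) A = 0\<^sub>m n n" by (simp add: m r)
  then have "poly_mat (p ^ e * r) A *\<^sub>v v = 0\<^sub>v n" using v by auto
  then have fe: "f dvd p ^ e" by (simp add: iff)
  have nf: "\<not> f dvd p ^ k" using nzv by (simp add: iff)
  obtain b where b: "p ^ e = f * b" using fe by (rule dvdE)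
  \<comment> \<open>A factor \<open>p\<close> in the cofactor \<open>b\<close> could be cancelled,
    making \<open>f\<close> divide \<open>p ^ k\<close>. Hence \<open>b\<close> is prime to
    \<open>p\<close>, and \<open>f\<close> is associated with \<open>p ^ e\<close>.\<close>
  have "\<not> p dvd b"
  proof
    assume "p dvd b"
    then obtain b' where "b = p * b'" by (rule dvdE)
    then have "p * p ^ k = p * (f * b')" using b by (simp add: Suc)
    then have "p ^ k = f * b'" using p by (auto simp: prime_elem_def)
    then show False using nf by simp
  qed
  moreover have "p ^ e dvd b * f" by (simp add: b)
  moreover have "e > 0" by (simp add: Suc)
  ultimately have "p ^ e dvd f" using prime_power_dvd_multD[OF p] by blast
  then show thesis using is_annihilator_associated[OF f fe] that by blast
qed

text \<open>Formulated for all divisors of \<open>m\<close> so that the induction on degree applies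
  to the cofactor left after splitting off the full power of one prime; the vectors for the two
  coprime factors are then added.\<close>

lemma ex_is_annihilator_dvd:
  assumes A: "A \<in> carrier_mat n n"
    and m: "\<And>g. poly_mat g A = 0\<^sub>m n n \<longleftrightarrow> m dvd g" and nz: "m \<noteq> 0" and "f dvd m"
  shows "\<exists>v. is_annihilator A v f"
  using assms(4)
proof (induction "degree f" arbitrary: f rule: less_induct)
  case less
  have f0: "f \<noteq> 0" using less.prems nz by auto
  show ?case
  proof (cases "degree f = 0")
    case True
    then have "f dvd 1" using f0 by (simp add: is_unit_iff_degree)
    then show ?thesis using is_annihilator_zero_vec[OF A] by blast
  next
    case False
    then obtain p where p: "prime_elem p" "degree p > 0" "p dvd f"
      using ex_prime_elem_dvd_poly[of f] by auto
    obtain e g where eg: "f = p ^ e * g" "\<not> p dvd g" using poly_power_factor[OF f0 p(2)] .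
    have "e \<noteq> 0" using eg p(3) by (cases e) auto
    then have "degree g < degree f" using eg f0 p(2) by (auto simp: degree_mult_eq degree_power_eq)
    moreover have "g dvd m" "p ^ e dvd m"
      using less.prems eg(1) by (auto intro: dvd_mult_left dvd_mult_right)
    ultimately obtain u v where "is_annihilator A u (p ^ e)" "is_annihilator A v g"
      using less.hyps ex_is_annihilator_prime_power[OF A m nz p(1)] by metis
    then show ?thesis using is_annihilator_add[OF A _ _ p(1) eg(2)] eg(1) by blast
  qed
qed

text \<open>Some vector has the same annihilator \<open>m\<close> as the whole matrix. Minimality of
  \<open>min_poly A\<close> gives \<open>m\<close> degree at least \<open>n\<close>, so
  \<open>m\<close> divides no nonzero polynomial of smaller degree.\<close>

lemma ex_cyclic_vector:
  assumes A: "A \<in> carrier_mat n n" and deg: "degree (min_poly A) = n"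
  obtains v where "v \<in> carrier_vec n"
    and "\<And>q. degree q < n \<Longrightarrow> poly_mat q A *\<^sub>v v = 0\<^sub>v n \<Longrightarrow> q = 0"
proof -
  let ?I = "{g. poly_mat g A = 0\<^sub>m n n}"
  have mp: "is_min_poly A (min_poly A)" by (rule is_min_poly_min_poly[OF A])
  obtain m where m: "m \<noteq> 0" "\<And>g. g \<in> ?I \<longleftrightarrow> m dvd g"
  proof (rule poly_ideal_principal[of "min_poly A" ?I])
    show "min_poly A \<in> ?I" "min_poly A \<noteq> 0" using mp A by (auto simp: is_min_poly_def)
    show "p + q \<in> ?I" if "p \<in> ?I" "q \<in> ?I" for p q
      using that by (simp add: poly_mat_add[OF A])
    show "p * q \<in> ?I" if "q \<in> ?I" for p q
      using that right_mult_zero_mat[OF poly_mat_carrier[OF A, of p]] by (simp add: poly_mat_mult[OF A])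
  qed auto
  have "m \<in> ?I" by (simp only: m(2) dvd_refl)
  then have dm: "n \<le> degree m" using mp A m(1) deg by (auto simp: is_min_poly_def)
  obtain v where v: "is_annihilator A v m"
    using ex_is_annihilator_dvd[OF A _ m(1) dvd_refl] m(2) by auto
  show thesis
  proof (rule that[of v])
    show "v \<in> carrier_vec n" using v A by (simp add: is_annihilator_def)
    fix q assume "degree q < n" "poly_mat q A *\<^sub>v v = 0\<^sub>v n"
    then show "q = 0" using v A dm dvd_imp_degree_le[of m q] by (auto simp: is_annihilator_def)
  qed
qed

text \<open>For a cyclic vector \<open>v\<close> the vectors \<open>A ^ j v\<close> with
  \<open>j < n\<close> form a basis, so \<open>X v = q(A) v\<close> for some \<open>q\<close>. Both
  \<open>X\<close> and \<open>q(A)\<close> commute with \<open>A\<close>, so they agree on the whole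
  basis.\<close>

lemma commuting_eq_poly_mat:
  assumes A: "A \<in> carrier_mat n n" and deg: "degree (min_poly A) = n"
    and X: "X \<in> carrier_mat n n" and comm: "X * A = A * X"
  obtains q where "X = poly_mat q A"
proof -
  obtain v where v: "v \<in> carrier_vec n"
    and cyc: "\<And>q. degree q < n \<Longrightarrow> poly_mat q A *\<^sub>v v = 0\<^sub>v n \<Longrightarrow> q = 0"
    using ex_cyclic_vector[OF A deg] by metis
  \<comment> \<open>The Krylov matrix: column \<open>j\<close> is \<open>A ^ j v\<close>.
    Multiplying it by a coefficient vector \<open>c\<close> evaluates the polynomial
    \<open>pol c\<close> at \<open>A\<close> and applies the result to \<open>v\<close>.\<close>
  define P where "P = mat n n (\<lambda>(r, j). ((A ^\<^sub>m j) *\<^sub>v v) $ r)"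
  have P: "P \<in> carrier_mat n n" by (simp add: P_def)
  have pw: "A ^\<^sub>m j \<in> carrier_mat n n" for j using A by simp
  define pol where "pol c = (\<Sum>i<n. monom (c $ i) i)" for c :: "'a vec"
  have coeff: "coeff (pol c) i = (if i < n then c $ i else 0)" for c i
    by (simp add: pol_def coeff_sum)
  have Pc: "P *\<^sub>v c = poly_mat (pol c) A *\<^sub>v v" if c: "c \<in> carrier_vec n" for c
  proof (rule eq_vecI)
    fix r assume "r < dim_vec (poly_mat (pol c) A *\<^sub>v v)"
    then have r: "r < n" using poly_mat_carrier[OF A, of "pol c"] by simp
    have d: "degree (pol c) \<le> n" by (rule degree_le) (auto simp: coeff)
    have "(P *\<^sub>v c) $ r = (\<Sum>j<n. (\<Sum>k<n. (A ^\<^sub>m j) $$ (r,k) * v $ k) * c $ j)"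
      using r c v pw P A by (auto simp: P_def scalar_prod_def lessThan_atLeast0 intro!: sum.cong)
    also have "\<dots> = (\<Sum>k<n. \<Sum>j<n. c $ j * (A ^\<^sub>m j) $$ (r,k) * v $ k)"
      by (subst sum.swap) (simp add: sum_distrib_left sum_distrib_right mult_ac)
    also have "\<dots> = (\<Sum>k<n. (\<Sum>j\<le>n. coeff (pol c) j * (A ^\<^sub>m j) $$ (r,k)) * v $ k)"
      by (simp add: coeff sum_distrib_right lessThan_Suc_atMost[symmetric])
    also have "\<dots> = (poly_mat (pol c) A *\<^sub>v v) $ r"
      using r v unfolding poly_mat_index[OF A d] by (simp add: scalar_prod_def lessThan_atLeast0)
    finally show "(P *\<^sub>v c) $ r = (poly_mat (pol c) A *\<^sub>v v) $ r" .
  qed (use P poly_mat_carrier[OF A, of "pol c"] in auto)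
  \<comment> \<open>A kernel vector of \<open>P\<close> holds the coefficients of a polynomial of
    degree below \<open>n\<close> killing \<open>v\<close>, which cyclicity makes zero.\<close>
  have "det P \<noteq> 0"
  proof
    assume "det P = 0"
    then obtain c where c: "c \<in> carrier_vec n" "c \<noteq> 0\<^sub>v n" "P *\<^sub>v c = 0\<^sub>v n"
      using det_0_iff_vec_prod_zero_field[OF P] by auto
    \<comment> \<open>The strict degree bound fails for \<open>n = 0\<close>, but there no nonzero
      \<open>c\<close> exists.\<close>
    then have "n > 0" by (cases n) auto
    then have "degree (pol c) < n" unfolding pol_def
      by (intro degree_sum_less) (auto intro: le_less_trans[OF degree_monom_le])
    then have "pol c = 0" using cyc c Pc by auto
    then have "c $ i = 0" if "i < n" for i using coeff[of c i] that by simp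
    then have "c = 0\<^sub>v n" using c(1) by (intro eq_vecI) auto
    with c(2) show False ..
  qed
  then obtain Q where Q: "Q \<in> carrier_mat n n" "P * Q = 1\<^sub>m n"
    using det_non_zero_imp_unit[OF P, of "()"] by (auto simp: Units_def ring_mat_simps)
  \<comment> \<open>The coordinates of \<open>X v\<close> in the Krylov basis, hence the
    coefficients of the polynomial sought.\<close>
  define c where "c = Q *\<^sub>v (X *\<^sub>v v)"
  have Xv: "X *\<^sub>v v \<in> carrier_vec n" by (rule mult_mat_vec_carrier[OF X v])
  have c: "c \<in> carrier_vec n" unfolding c_def by (rule mult_mat_vec_carrier[OF Q(1) Xv])
  have "P *\<^sub>v c = X *\<^sub>v v"
    using assoc_mult_mat_vec[OF P Q(1) Xv] Q(2) Xv by (simp add: c_def)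
  then have eqv: "X *\<^sub>v v = poly_mat (pol c) A *\<^sub>v v" using Pc[OF c] by simp
  let ?q = "poly_mat (pol c) A"
  have q: "?q \<in> carrier_mat n n" using A by simp
  have cX: "X * A ^\<^sub>m j = A ^\<^sub>m j * X" for j by (rule pow_mat_commute[OF A X comm])
  have cq: "?q * A ^\<^sub>m j = A ^\<^sub>m j * ?q" for j
    by (rule pow_mat_commute[OF A q poly_mat_commute[OF A A refl, symmetric]])
  \<comment> \<open>Commuting with powers of \<open>A\<close> carries the equality at
    \<open>v\<close> to every column of \<open>P\<close>; the right inverse \<open>Q\<close> then
    cancels \<open>P\<close>.\<close>
  have "X * P = ?q * P"
  proof (rule mat_col_eqI)
    fix j assume "j < dim_col (?q * P)"
    then have j: "j < n" using P by simp
    have cP: "col P j = A ^\<^sub>m j *\<^sub>v v" using j A pw[of j] by (intro eq_vecI) (auto simp: P_def)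
    have "X *\<^sub>v (A ^\<^sub>m j *\<^sub>v v) = A ^\<^sub>m j *\<^sub>v (X *\<^sub>v v)"
      by (simp only: assoc_mult_mat_vec[OF X pw v, symmetric] assoc_mult_mat_vec[OF pw X v, symmetric] cX)
    also have "\<dots> = ?q *\<^sub>v (A ^\<^sub>m j *\<^sub>v v)"
      by (simp only: eqv assoc_mult_mat_vec[OF q pw v, symmetric] assoc_mult_mat_vec[OF pw q v, symmetric] cq)
    finally show "col (X * P) j = col (?q * P) j"
      using col_mult2[OF X P j] col_mult2[OF q P j] cP by simp
  qed (use X P q in auto)
  then have "X * P * Q = ?q * P * Q" by simp
  then have "X = ?q" using X P Q q by (simp add: assoc_mult_mat)
  then show thesis by (rule that)
qed

section \<open>Subspaces closed under differentiation\<close>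

context differential_field
begin

lemma deriv_0: "D 0 = 0" and deriv_1: "D 1 = 0"
  using constants_closed(1,2) by (simp_all add: constants_def)

lemma deriv_sum: "D (sum f S) = (\<Sum>i\<in>S. D (f i))"
  by (induction S rule: infinite_finite_induct) (auto simp: deriv_0 deriv_add)

lemma mat_deriv_add:
  assumes "A \<in> carrier_mat m n" "B \<in> carrier_mat m n"
  shows "mat_deriv D (A + B) = mat_deriv D A + mat_deriv D B"
  using assms by (intro eq_matI) (auto simp: mat_deriv_def deriv_add)

lemma mat_deriv_mult:
  assumes "A \<in> carrier_mat m k" "B \<in> carrier_mat k n"
  shows "mat_deriv D (A * B) = mat_deriv D A * B + A * mat_deriv D B"
  using assms
  by (intro eq_matI) (auto simp: mat_deriv_def scalar_prod_def deriv_sum deriv_mult sum.distrib)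

text \<open>The product rule applied to the Horner step yields only polynomials in \<open>A\<close>,
  since the derivative of \<open>A\<close> is one itself; that derivative enters through the term
  \<open>p * d\<close>.\<close>

lemma mat_deriv_poly_mat:
  assumes A: "A \<in> carrier_mat n n" and d: "mat_deriv D A = poly_mat d A"
  shows "\<exists>q. mat_deriv D (poly_mat p A) = poly_mat q A"
proof (induction p)
  case 0
  have "mat_deriv D (poly_mat 0 A) = poly_mat 0 A"
    unfolding poly_mat_0[OF A] by (rule eq_matI) (auto simp: mat_deriv_def deriv_0)
  then show ?case ..
next
  case (pCons a p)
  then obtain q where q: "mat_deriv D (poly_mat p A) = poly_mat q A" by blast
  note P = poly_mat_carrier[OF A, of p]
  have "mat_deriv D (a \<cdot>\<^sub>m 1\<^sub>m n) = D a \<cdot>\<^sub>m 1\<^sub>m n"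
    by (rule eq_matI) (auto simp: mat_deriv_def deriv_0 deriv_1 deriv_mult)
  then have "mat_deriv D (poly_mat (pCons a p) A)
      = D a \<cdot>\<^sub>m 1\<^sub>m n + (poly_mat q A * A + poly_mat p A * poly_mat d A)"
    using A P mult_carrier_mat[OF P A]
    by (simp add: poly_mat_pCons[OF A] mat_deriv_add[of _ n n] mat_deriv_mult[OF P A] q d)
  also have "\<dots> = poly_mat (pCons (D a) q + p * d) A"
    unfolding poly_mat_add[OF A] poly_mat_pCons[OF A] poly_mat_mult[OF A]
    by (rule assoc_add_mat[of _ n n, symmetric])
      (simp_all add: mult_carrier_mat[OF poly_mat_carrier[OF A] A]
        mult_carrier_mat[OF poly_mat_carrier[OF A] poly_mat_carrier[OF A]])
  finally show ?case ..
qed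

section \<open>Constant matrices of minimal support\<close>

definition supp_mat :: "'a mat \<Rightarrow> (nat \<times> nat) set" where
  "supp_mat A = {(i, j). i < dim_row A \<and> j < dim_col A \<and> A $$ (i, j) \<noteq> 0}"

lemma finite_supp_mat [simp]: "finite (supp_mat A)"
  by (rule finite_subset[of _ "{..<dim_row A} \<times> {..<dim_col A}"]) (auto simp: supp_mat_def)

text \<open>Minimality is sought among the nonzero members supported inside
  \<open>supp_mat A\<close>, so that subtracting a multiple of \<open>C\<close> from
  \<open>A\<close> creates no new nonzero entry, while the entry 1 at \<open>(i, j)\<close> allows
  one to be cleared.\<close>

lemma constant_mat_supp_subset:
  assumes W: "W \<subseteq> carrier_mat m n"
    and smult: "\<And>c A. A \<in> W \<Longrightarrow> c \<cdot>\<^sub>m A \<in> W"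
    and deriv: "\<And>A. A \<in> W \<Longrightarrow> mat_deriv D A \<in> W"
    and A: "A \<in> W" "A \<noteq> 0\<^sub>m m n"
  obtains C i j where "C \<in> W" "mat_deriv D C = 0\<^sub>m m n" "supp_mat C \<subseteq> supp_mat A"
    "(i, j) \<in> supp_mat A" "C $$ (i, j) = 1"
proof -
  let ?P = "\<lambda>B. B \<in> W \<and> B \<noteq> 0\<^sub>m m n \<and> supp_mat B \<subseteq> supp_mat A"
  obtain B where B: "?P B" and min: "\<And>C. ?P C \<Longrightarrow> card (supp_mat B) \<le> card (supp_mat C)"
    using ex_has_least_nat[of ?P A "\<lambda>B. card (supp_mat B)"] A by blast
  have Bc: "B \<in> carrier_mat m n" using B W by auto
  then obtain i j where ij: "i < m" "j < n" "B $$ (i,j) \<noteq> 0"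
    using B by (metis carrier_matD eq_matI index_zero_mat)
  define C where "C = inverse (B $$ (i,j)) \<cdot>\<^sub>m B"
  have CW: "C \<in> W" using B smult by (simp add: C_def)
  have Cc: "C \<in> carrier_mat m n" using CW W by auto
  have sC: "supp_mat C \<subseteq> supp_mat B" by (auto simp: C_def supp_mat_def)
  have C1: "C $$ (i,j) = 1" using ij Bc by (simp add: C_def)
  have "mat_deriv D C = 0\<^sub>m m n"
  proof (rule ccontr)
    assume nz: "mat_deriv D C \<noteq> 0\<^sub>m m n"
    \<comment> \<open>Both 0 and 1 have derivative 0: zero entries stay zero and the entry at
      \<open>(i, j)\<close> disappears.\<close>
    have "supp_mat (mat_deriv D C) \<subseteq> supp_mat C - {(i,j)}"
      using C1 ij Cc by (auto simp: supp_mat_def mat_deriv_def deriv_0 deriv_1)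
    moreover have ijB: "(i,j) \<in> supp_mat B" using ij Bc by (simp add: supp_mat_def)
    ultimately have "supp_mat (mat_deriv D C) \<subset> supp_mat B" using sC by auto
    then have "card (supp_mat (mat_deriv D C)) < card (supp_mat B)"
      and "supp_mat (mat_deriv D C) \<subseteq> supp_mat A"
      using B by (auto intro: psubset_card_mono)
    then show False using min[of "mat_deriv D C"] nz deriv[OF CW] by auto
  qed
  moreover have "(i,j) \<in> supp_mat A" using B ij Bc by (auto simp: supp_mat_def)
  ultimately show thesis using that CW C1 sC B by blast
qed

text \<open>Induction on the number of nonzero entries: a constant member supported inside
  \<open>A\<close> clears one entry of \<open>A\<close> and adds none.\<close>

lemma deriv_closed_span_constants:
  assumes W: "W \<subseteq> carrier_mat m n"
    and add: "\<And>A B. A \<in> W \<Longrightarrow> B \<in> W \<Longrightarrow> A + B \<in> W"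
    and smult: "\<And>c A. A \<in> W \<Longrightarrow> c \<cdot>\<^sub>m A \<in> W"
    and deriv: "\<And>A. A \<in> W \<Longrightarrow> mat_deriv D A \<in> W"
    and "A \<in> W"
  shows "\<exists>(k :: nat) f C. (\<forall>j\<in>{1..k}. C j \<in> W \<and> mat_deriv D (C j) = 0\<^sub>m m n) \<and>
    A = (\<Oplus>\<^bsub>module_mat TYPE('a) m n\<^esub> j \<in> {1..k}. f j \<cdot>\<^sub>m C j)"
  using assms(5)
proof (induction "card (supp_mat A)" arbitrary: A rule: less_induct)
  case less
  have Ac: "A \<in> carrier_mat m n" using less.prems W by auto
  show ?case
  proof (cases "A = 0\<^sub>m m n")
    case True
    \<comment> \<open>The zero matrix is the empty sum, with \<open>k = 0\<close> and arbitrary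
      \<open>f\<close> and \<open>C\<close>.\<close>
    have "A = (\<Oplus>\<^bsub>module_mat TYPE('a) m n\<^esub> j \<in> {1..0::nat}. 0 \<cdot>\<^sub>m A)"
      unfolding True by (subst finsum_mat) auto
    then show ?thesis by (intro exI[of _ 0] exI[of _ "\<lambda>_. 0"] exI[of _ "\<lambda>_. A"]) auto
  next
    case False
    obtain B r s where B: "B \<in> W" "mat_deriv D B = 0\<^sub>m m n" "supp_mat B \<subseteq> supp_mat A"
      "(r, s) \<in> supp_mat A" "B $$ (r, s) = 1"
      using constant_mat_supp_subset[OF W smult deriv less.prems False] .
    have Bc: "B \<in> carrier_mat m n" using B W by auto
    \<comment> \<open>Since \<open>B\<close> has entry 1 at \<open>(r, s)\<close>, this multiple of
      \<open>B\<close> cancels the entry of \<open>A\<close> there.\<close>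
    define a where "a = A $$ (r,s)"
    define A' where "A' = A + (- a) \<cdot>\<^sub>m B"
    have A'W: "A' \<in> W" unfolding A'_def by (intro add smult less.prems B)
    have "supp_mat A' \<subseteq> supp_mat A - {(r,s)}"
    proof
      fix x assume x: "x \<in> supp_mat A'"
      obtain i j where ij: "x = (i, j)" by fastforce
      have lt: "i < m" "j < n" and ne: "A $$ (i,j) - a * B $$ (i,j) \<noteq> 0"
        using x Ac Bc by (auto simp: ij supp_mat_def A'_def)
      have "(i,j) \<noteq> (r,s)" using ne B(5) by (auto simp: a_def)
      moreover have "(i,j) \<in> supp_mat A"
      proof (rule ccontr)
        assume nA: "(i,j) \<notin> supp_mat A"
        then have "A $$ (i,j) = 0" "B $$ (i,j) = 0"
          using lt Ac Bc subsetD[OF B(3), of "(i,j)"] by (auto simp: supp_mat_def)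
        with ne show False by simp
      qed
      ultimately show "x \<in> supp_mat A - {(r,s)}" by (simp add: ij)
    qed
    then have "supp_mat A' \<subset> supp_mat A" using B(4) by auto
    then have "card (supp_mat A') < card (supp_mat A)" by (intro psubset_card_mono) auto
    from less.hyps[OF this A'W] obtain k :: nat and f C
      where C: "\<And>j. j \<in> {1..k} \<Longrightarrow> C j \<in> W \<and> mat_deriv D (C j) = 0\<^sub>m m n"
        and A': "A' = (\<Oplus>\<^bsub>module_mat TYPE('a) m n\<^esub> j \<in> {1..k}. f j \<cdot>\<^sub>m C j)" by blast
    \<comment> \<open>The removed multiple of \<open>B\<close> is appended as the new last summand;
      indices \<open>1..k\<close> keep their values.\<close>
    define f' C' where "f' = f(Suc k := a)" and "C' = C(Suc k := B)"
    have Cc: "C j \<in> carrier_mat m n" if "j \<in> {1..k}" for j using C[OF that] W by auto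
    have C': "C' j \<in> W \<and> mat_deriv D (C' j) = 0\<^sub>m m n" if "j \<in> {1..Suc k}" for j
      using that C B by (auto simp: C'_def le_Suc_eq)
    then have Cc': "C' j \<in> carrier_mat m n" if "j \<in> {1..Suc k}" for j using that W by blast
    have "A = A' + a \<cdot>\<^sub>m B" using Ac Bc by (intro eq_matI) (auto simp: A'_def)
    also have "\<dots> = (\<Oplus>\<^bsub>module_mat TYPE('a) m n\<^esub> j \<in> {1..Suc k}. f' j \<cdot>\<^sub>m C' j)"
    proof -
      have 1: "A' = mat m n (\<lambda>rc. \<Sum>j\<in>{1..k}. (f j \<cdot>\<^sub>m C j) $$ rc)"
        unfolding A' by (rule finsum_mat) (use Cc in auto)
      have 2: "(\<Oplus>\<^bsub>module_mat TYPE('a) m n\<^esub> j \<in> {1..Suc k}. f' j \<cdot>\<^sub>m C' j)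
          = mat m n (\<lambda>rc. \<Sum>j\<in>{1..Suc k}. (f' j \<cdot>\<^sub>m C' j) $$ rc)"
        by (rule finsum_mat) (use Cc' in auto)
      have 3: "(\<Sum>j\<in>{1..k}. (f' j \<cdot>\<^sub>m C' j) $$ rc) = (\<Sum>j\<in>{1..k}. (f j \<cdot>\<^sub>m C j) $$ rc)" for rc
        by (rule sum.cong) (auto simp: f'_def C'_def)
      show ?thesis unfolding 2 1 using Bc
        by (intro eq_matI) (simp_all add: 3[unfolded One_nat_def] f'_def[THEN fun_cong, of "Suc k"] C'_def[THEN fun_cong, of "Suc k"])
    qed
    finally show ?thesis using C' by blast
  qed
qed

end

theorem theorem6:
  fixes D :: "'a :: field \<Rightarrow> 'a" and M :: "'a mat" and n :: nat
  assumes "differential_field D"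
    and "M \<in> carrier_mat n n"
    and "nonderogatory M"
    and "M * mat_deriv D M = mat_deriv D M * M"
  shows "type1 D n M"
proof -
  interpret differential_field D by (rule assms(1))
  note M = assms(2)
  let ?W = "range (\<lambda>p. poly_mat p M)"
  \<comment> \<open>The characteristic polynomial has degree \<open>n\<close>, and here it equals
    the minimal one.\<close>
  have deg: "degree (min_poly M) = n"
    using degree_monic_char_poly[OF M] assms(3) by (simp add: nonderogatory_def)
  have M'c: "mat_deriv D M \<in> carrier_mat n n" using M by (simp add: mat_deriv_def)
  \<comment> \<open>The hypothesis on the derivative enters here, and through \<open>d\<close> it
    makes \<open>?W\<close> closed under differentiation.\<close>
  obtain d where d: "mat_deriv D M = poly_mat d M"
    using commuting_eq_poly_mat[OF M deg M'c assms(4)[symmetric]] .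
  \<comment> \<open>\<open>M\<close> commutes with itself, so the same lemma shows that it lies in
    \<open>?W\<close>.\<close>
  obtain x where x: "M = poly_mat x M"
    using commuting_eq_poly_mat[OF M deg M refl] .
  have "\<exists>(k :: nat) f C. (\<forall>j\<in>{1..k}. C j \<in> ?W \<and> mat_deriv D (C j) = 0\<^sub>m n n) \<and>
    M = (\<Oplus>\<^bsub>module_mat TYPE('a) n n\<^esub> j \<in> {1..k}. f j \<cdot>\<^sub>m C j)"
  proof (rule deriv_closed_span_constants)
    show "?W \<subseteq> carrier_mat n n" using M by auto
    show "A + B \<in> ?W" if "A \<in> ?W" "B \<in> ?W" for A B
      using that by (auto simp: poly_mat_add[OF M, symmetric])
    show "c \<cdot>\<^sub>m A \<in> ?W" if "A \<in> ?W" for c A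
      using that by (auto simp: poly_mat_smult[OF M, symmetric])
    show "mat_deriv D A \<in> ?W" if "A \<in> ?W" for A
      using that mat_deriv_poly_mat[OF M d] by force
    show "M \<in> ?W" using x by blast
  qed
  then obtain k :: nat and f C where C: "\<And>j. j \<in> {1..k} \<Longrightarrow> C j \<in> ?W \<and> mat_deriv D (C j) = 0\<^sub>m n n"
    and eq: "M = (\<Oplus>\<^bsub>module_mat TYPE('a) n n\<^esub> j \<in> {1..k}. f j \<cdot>\<^sub>m C j)" by blast
  have "C j \<in> const_mat D n" if j: "j \<in> {1..k}" for j
  proof -
    have Cc: "C j \<in> carrier_mat n n" using C[OF j] M by auto
    have "D (C j $$ (r, s)) = 0" if "r < n" "s < n" for r s
      using arg_cong[OF conjunct2[OF C[OF j]], of "\<lambda>X. X $$ (r, s)"] that Cc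
      by (simp add: mat_deriv_def)
    then show ?thesis using Cc by (auto simp: const_mat_def constants_def elements_mat_def)
  qed
  \<comment> \<open>Polynomials in the same matrix commute because polynomial multiplication
    does.\<close>
  moreover have "C i * C j = C j * C i" if i: "i \<in> {1..k}" and j: "j \<in> {1..k}" for i j
  proof -
    obtain p q where "C i = poly_mat p M" "C j = poly_mat q M" using C[OF i] C[OF j] by blast
    then show ?thesis by (simp add: poly_mat_mult[OF M, symmetric] mult.commute)
  qed
  ultimately show ?thesis unfolding type1_def using eq by blast
qed

end
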